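(* Let $S$ be a solid and let $x,y,z\in S$. Then $$xy+xz=x(y+z)\iff \Big(e(x)(y+z)=e(x)y+e(x)z\ \ \text{or}\ \ R(x)\le R(y)+R(z)\Big).$$
   Context: A solid is a set $S$ with two binary operations $+$ and $\cdot$ (written $xy$) and a binary relation $\le$ satisfying the following axioms (all variables range over $S$). (A1) $+$ is associative and commutative. (A2) For each $x$ there is $e$ with $x+e=x$ such that $e+f=e$ for every $f$ with $x+f=x$; this $e$ is unique and is denoted $e(x)$ (the magnitude of $x$). An element $x$ with $x=e(x)$ is called a magnitude. (A3) For each $x$ there is $s$ with $x+s=e(x)$ and $e(s)=e(x)$; it is unique and denoted $-x$; write $x-y$ for $x+(-y)$. (A4) $e(x+y)=e(x)$ or $e(x+y)=e(y)$. (M1) $\cdot$ is associative and commutative. (M2) For each $x\neq e(x)$ there is $u$ with $xu=x$ such that $uv=u$ for every $v$ with $xv=x$; it is unique and denoted $u(x)$. (M3) For each $x\ne e(x)$ there is $d$ with $xd=u(x)$ and $u(d)=u(x)$; it is unique and denoted $x^{-1}$; write $y/x$ for $yx^{-1}$. (M4) If $x\neq e(x)$ and $y\ne e(y)$ then $u(xy)=u(x)$ or $u(xy)=u(y)$. (O1) $\le$ is a total order (reflexive, antisymmetric, transitive, total); $x<y$ means $x\le y$ and $x\ne y$. (O2) $x\le y\Rightarrow x+z\le y+z$. (O3) $y+e(x)=e(x)\Rightarrow (y\le e(x)$ and $-y\le e(x))$. (O4) $(e(x)<x$ and $y\le z)\Rightarrow xy\le xz$. (O5) $e(y)\le y\le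 z\Rightarrow e(x)y\le e(x)z$. (AM1) For all $x,y$ there is $z$ with $e(x)y=e(z)$. (AM2) $e(xy)=e(x)y+e(y)x$. (AM3) If $x\ne e(x)$ then $e(u(x))=e(x)/x$. (AM4) (distributivity axiom) $xy+xz=x(y+z)+e(x)y+e(x)z$. (AM5) $-(xy)=(-x)y$. (E1) There is $m$ with $m+x=x$ for all $x$; it is unique, called zero and denoted $0$. (E2) There is $u$ with $ux=x$ for all $x$; it is unique, called one and denoted $1$. (E3) There is $M$ with $e(x)+M=M$ for all $x$. (E4) There is $x$ with $e(x)\ne 0$ and $e(x)\ne M$. (E5) For every $x$ there is $a$ with $x=a+e(x)$ and $e(a)=0$. (E6) If $x,y$ are magnitudes with $x<y$, there is $z$ with $z\ne e(z)$ and $x<z<y$. Further notation: $S^*=\{x\in S: x\ne e(x)\}$ (zeroless elements). $x$ is positive if $e(x)\le x$ and negative if $x<e(x)$; $|x|=x$ if $x$ is positive and $|x|=-x$ if $x$ is negative. $x$ is precise if $e(x)=0$. The relative uncertainty $R(x)$ is $e(u(x))$ if $x\ne e(x)$, and $M$ (from (E3)) if $x=e(x)$. *)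

theory Defs
  imports Main
begin

definition mag :: "('a \<Rightarrow> 'a \<Rightarrow> 'a) \<Rightarrow> 'a \<Rightarrow> 'a" where
  "mag pl x = (THE e. pl x e = x \<and> (\<forall>f. pl x f = x \<longrightarrow> pl e f = e))"

definition neg :: "('a \<Rightarrow> 'a \<Rightarrow> 'a) \<Rightarrow> 'a \<Rightarrow> 'a" where
  "neg pl x = (THE s. pl x s = mag pl x \<and> mag pl s = mag pl x)"

definition unt :: "('a \<Rightarrow> 'a \<Rightarrow> 'a) \<Rightarrow> 'a \<Rightarrow> 'a" where
  "unt tm x = (THE u. tm x u = x \<and> (\<forall>v. tm x v = x \<longrightarrow> tm u v = u))"

definition minv :: "('a \<Rightarrow> 'a \<Rightarrow> 'a) \<Rightarrow> 'a \<Rightarrow> 'a" where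
  "minv tm x = (THE d. tm x d = unt tm x \<and> unt tm d = unt tm x)"

definition szero :: "('a \<Rightarrow> 'a \<Rightarrow> 'a) \<Rightarrow> 'a" where
  "szero pl = (THE m. \<forall>x. pl m x = x)"

definition bigM :: "('a \<Rightarrow> 'a \<Rightarrow> 'a) \<Rightarrow> 'a" where
  "bigM pl = (SOME M. \<forall>x. pl (mag pl x) M = M)"

definition relunc :: "('a \<Rightarrow> 'a \<Rightarrow> 'a) \<Rightarrow> ('a \<Rightarrow> 'a \<Rightarrow> 'a) \<Rightarrow> 'a \<Rightarrow> 'a" where
  "relunc pl tm x = (if x \<noteq> mag pl x then mag pl (unt tm x) else bigM pl)"

definition solid :: "('a \<Rightarrow> 'a \<Rightarrow> 'a) \<Rightarrow> ('a \<Rightarrow> 'a \<Rightarrow> 'a) \<Rightarrow> ('a \<Rightarrow> 'a \<Rightarrow> bool) \<Rightarrow> bool" where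
  "solid pl tm le \<longleftrightarrow>
    \<comment> \<open>A1\<close>
    (\<forall>x y z. pl (pl x y) z = pl x (pl y z)) \<and> (\<forall>x y. pl x y = pl y x) \<and>
    \<comment> \<open>A2\<close>
    (\<forall>x. \<exists>!e. pl x e = x \<and> (\<forall>f. pl x f = x \<longrightarrow> pl e f = e)) \<and>
    \<comment> \<open>A3\<close>
    (\<forall>x. \<exists>!s. pl x s = mag pl x \<and> mag pl s = mag pl x) \<and>
    \<comment> \<open>A4\<close>
    (\<forall>x y. mag pl (pl x y) = mag pl x \<or> mag pl (pl x y) = mag pl y) \<and>
    \<comment> \<open>M1\<close>
    (\<forall>x y z. tm (tm x y) z = tm x (tm y z)) \<and> (\<forall>x y. tm x y = tm y x) \<and>
    \<comment> \<open>M2\<close>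
    (\<forall>x. x \<noteq> mag pl x \<longrightarrow> (\<exists>!u. tm x u = x \<and> (\<forall>v. tm x v = x \<longrightarrow> tm u v = u))) \<and>
    \<comment> \<open>M3\<close>
    (\<forall>x. x \<noteq> mag pl x \<longrightarrow> (\<exists>!d. tm x d = unt tm x \<and> unt tm d = unt tm x)) \<and>
    \<comment> \<open>M4\<close>
    (\<forall>x y. x \<noteq> mag pl x \<longrightarrow> y \<noteq> mag pl y \<longrightarrow>
        unt tm (tm x y) = unt tm x \<or> unt tm (tm x y) = unt tm y) \<and>
    \<comment> \<open>O1\<close>
    (\<forall>x. le x x) \<and> (\<forall>x y. le x y \<longrightarrow> le y x \<longrightarrow> x = y) \<and>
    (\<forall>x y z. le x y \<longrightarrow> le y z \<longrightarrow> le x z) \<and> (\<forall>x y. le x y \<or> le y x) \<and>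
    \<comment> \<open>O2\<close>
    (\<forall>x y z. le x y \<longrightarrow> le (pl x z) (pl y z)) \<and>
    \<comment> \<open>O3\<close>
    (\<forall>x y. pl y (mag pl x) = mag pl x \<longrightarrow> le y (mag pl x) \<and> le (neg pl y) (mag pl x)) \<and>
    \<comment> \<open>O4\<close>
    (\<forall>x y z. (le (mag pl x) x \<and> mag pl x \<noteq> x) \<and> le y z \<longrightarrow> le (tm x y) (tm x z)) \<and>
    \<comment> \<open>O5\<close>
    (\<forall>x y z. le (mag pl y) y \<and> le y z \<longrightarrow> le (tm (mag pl x) y) (tm (mag pl x) z)) \<and>
    \<comment> \<open>AM1\<close>
    (\<forall>x y. \<exists>z. tm (mag pl x) y = mag pl z) \<and>
    \<comment> \<open>AM2\<close>
    (\<forall>x y. mag pl (tm x y) = pl (tm (mag pl x) y) (tm (mag pl y) x)) \<and>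
    \<comment> \<open>AM3\<close>
    (\<forall>x. x \<noteq> mag pl x \<longrightarrow> mag pl (unt tm x) = tm (mag pl x) (minv tm x)) \<and>
    \<comment> \<open>AM4\<close>
    (\<forall>x y z. pl (tm x y) (tm x z) =
        pl (pl (tm x (pl y z)) (tm (mag pl x) y)) (tm (mag pl x) z)) \<and>
    \<comment> \<open>AM5\<close>
    (\<forall>x y. neg pl (tm x y) = tm (neg pl x) y) \<and>
    \<comment> \<open>E1\<close>
    (\<exists>m. \<forall>x. pl m x = x) \<and>
    \<comment> \<open>E2\<close>
    (\<exists>u. \<forall>x. tm u x = x) \<and>
    \<comment> \<open>E3\<close>
    (\<exists>M. \<forall>x. pl (mag pl x) M = M) \<and>
    \<comment> \<open>E4\<close>
    (\<exists>x. mag pl x \<noteq> szero pl \<and> mag pl x \<noteq> bigM pl) \<and>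
    \<comment> \<open>E5\<close>
    (\<forall>x. \<exists>a. x = pl a (mag pl x) \<and> mag pl a = szero pl) \<and>
    \<comment> \<open>E6\<close>
    (\<forall>x y. x = mag pl x \<longrightarrow> y = mag pl y \<longrightarrow> le x y \<longrightarrow> x \<noteq> y \<longrightarrow>
        (\<exists>z. z \<noteq> mag pl z \<and> le x z \<and> x \<noteq> z \<and> le z y \<and> z \<noteq> y))"

end

theory Submission
  imports Defs
begin

text \<open>
  Write \<open>A = e(x)(y + z)\<close>, \<open>B = e(x)y + e(x)z\<close> and \<open>C = x e(y) + x e(z)\<close>. Magnitudes are
  linearly ordered and their sum is their maximum, so the distributivity axiom says that
  distributivity holds iff \<open>B \<le> max A C\<close>; as always \<open>A \<le> B\<close>, this means \<open>A = B\<close> or \<open>B \<le> C\<close>.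
  If \<open>A \<noteq> B\<close>, then \<open>y\<close> and \<open>z\<close> cancel so strongly that they are zeroless and \<open>|y| \<le> 2|z|\<close>,
  \<open>|z| \<le> 2|y|\<close>, whence \<open>f y = f z\<close> for every magnitude \<open>f\<close>. For zeroless \<open>x\<close> we then get
  \<open>B = x y R(x)\<close> and \<open>C = x y (R(y) + R(z))\<close>, and the factors \<open>x\<close>, \<open>y\<close> cancel because
  \<open>1/2 \<le> u(x) \<le> 2\<close> gives \<open>f u(x) = f\<close>. For a magnitude \<open>x\<close> one has \<open>C \<le> A\<close>, while
  \<open>R(x)\<close> is the largest magnitude and exceeds \<open>R(y) + R(z)\<close>.
\<close>

section \<open>The axioms of a solid as rules\<close>

locale solid_structure =
  fixes pl :: "'a \<Rightarrow> 'a \<Rightarrow> 'a" (infixl "\<oplus>" 65)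
    and tm :: "'a \<Rightarrow> 'a \<Rightarrow> 'a" (infixl "\<odot>" 70)
    and le :: "'a \<Rightarrow> 'a \<Rightarrow> bool" (infix "\<sqsubseteq>" 50)
  assumes solid: "solid pl tm le"
begin

abbreviation e :: "'a \<Rightarrow> 'a" where "e \<equiv> mag pl"
abbreviation ng :: "'a \<Rightarrow> 'a" where "ng \<equiv> neg pl"
abbreviation u :: "'a \<Rightarrow> 'a" where "u \<equiv> unt tm"
abbreviation iv :: "'a \<Rightarrow> 'a" where "iv \<equiv> minv tm"

text \<open>The quantified forms match the conjuncts of \<open>solid\<close> literally, so plain
  assumption closes them; \<open>rule_format\<close> then makes them usable as rules.\<close>

lemma add_assoc [rule_format]: "\<forall>x y z. x \<oplus> y \<oplus> z = x \<oplus> (y \<oplus> z)"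
  and add_comm [rule_format]: "\<forall>x y. x \<oplus> y = y \<oplus> x"
  and mag_ex1 [rule_format]: "\<forall>x. \<exists>!a. x \<oplus> a = x \<and> (\<forall>f. x \<oplus> f = x \<longrightarrow> a \<oplus> f = a)"
  and neg_ex1 [rule_format]: "\<forall>x. \<exists>!s. x \<oplus> s = e x \<and> e s = e x"
  and mag_add_cases [rule_format]: "\<forall>x y. e (x \<oplus> y) = e x \<or> e (x \<oplus> y) = e y"
  and mul_assoc [rule_format]: "\<forall>x y z. x \<odot> y \<odot> z = x \<odot> (y \<odot> z)"
  and mul_comm [rule_format]: "\<forall>x y. x \<odot> y = y \<odot> x"
  and unt_ex1 [rule_format]:
    "\<forall>x. x \<noteq> e x \<longrightarrow> (\<exists>!w. x \<odot> w = x \<and> (\<forall>v. x \<odot> v = x \<longrightarrow> w \<odot> v = w))"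
  and minv_ex1 [rule_format]: "\<forall>x. x \<noteq> e x \<longrightarrow> (\<exists>!d. x \<odot> d = u x \<and> u d = u x)"
  and le_refl [rule_format]: "\<forall>x. x \<sqsubseteq> x"
  and le_antisym [rule_format]: "\<forall>x y. x \<sqsubseteq> y \<longrightarrow> y \<sqsubseteq> x \<longrightarrow> x = y"
  and le_trans [rule_format, trans]: "\<forall>x y z. x \<sqsubseteq> y \<longrightarrow> y \<sqsubseteq> z \<longrightarrow> x \<sqsubseteq> z"
  and le_total [rule_format]: "\<forall>x y. x \<sqsubseteq> y \<or> y \<sqsubseteq> x"
  and add_right_mono [rule_format]: "\<forall>x y z. x \<sqsubseteq> y \<longrightarrow> x \<oplus> z \<sqsubseteq> y \<oplus> z"
  and le_mag_if_absorbed [rule_format]: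
    "\<forall>x y. y \<oplus> e x = e x \<longrightarrow> y \<sqsubseteq> e x \<and> ng y \<sqsubseteq> e x"
  and mul_mono_conj [rule_format]:
    "\<forall>x y z. (e x \<sqsubseteq> x \<and> e x \<noteq> x) \<and> y \<sqsubseteq> z \<longrightarrow> x \<odot> y \<sqsubseteq> x \<odot> z"
  and mag_mul_mono_conj [rule_format]:
    "\<forall>x y z. e y \<sqsubseteq> y \<and> y \<sqsubseteq> z \<longrightarrow> e x \<odot> y \<sqsubseteq> e x \<odot> z"
  and mag_mul_ex [rule_format]: "\<forall>x y. \<exists>z. e x \<odot> y = e z"
  and mag_mul [rule_format]: "\<forall>x y. e (x \<odot> y) = e x \<odot> y \<oplus> e y \<odot> x"
  and mag_unt [rule_format]: "\<forall>x. x \<noteq> e x \<longrightarrow> e (u x) = e x \<odot> iv x"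
  and weak_distrib [rule_format]:
    "\<forall>x y z. x \<odot> y \<oplus> x \<odot> z = x \<odot> (y \<oplus> z) \<oplus> e x \<odot> y \<oplus> e x \<odot> z"
  and neg_mul [rule_format]: "\<forall>x y. ng (x \<odot> y) = ng x \<odot> y"
  and zero_ex: "\<exists>m. \<forall>x. m \<oplus> x = x"
  and one_ex: "\<exists>w. \<forall>x. w \<odot> x = x"
  and bigM_ex: "\<exists>M. \<forall>x. e x \<oplus> M = M"
  and nonzero_mag_ex: "\<exists>x. e x \<noteq> szero pl \<and> e x \<noteq> bigM pl"
  and zeroless_between [rule_format]:
    "\<forall>x y. x = e x \<longrightarrow> y = e y \<longrightarrow> x \<sqsubseteq> y \<longrightarrow> x \<noteq> y \<longrightarrow>
      (\<exists>z. z \<noteq> e z \<and> x \<sqsubseteq> z \<and> x \<noteq> z \<and> z \<sqsubseteq> y \<and> z \<noteq> y)"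
  using solid unfolding solid_def by - (elim conjE, assumption)+

lemma le_magI: "y \<oplus> e x = e x \<Longrightarrow> y \<sqsubseteq> e x"
  using le_mag_if_absorbed by blast

lemma mul_left_mono: "e x \<sqsubseteq> x \<Longrightarrow> e x \<noteq> x \<Longrightarrow> y \<sqsubseteq> z \<Longrightarrow> x \<odot> y \<sqsubseteq> x \<odot> z"
  using mul_mono_conj by blast

lemma mag_mul_mono: "e y \<sqsubseteq> y \<Longrightarrow> y \<sqsubseteq> z \<Longrightarrow> e x \<odot> y \<sqsubseteq> e x \<odot> z"
  using mag_mul_mono_conj by blast

subsection \<open>Magnitudes\<close>

lemma add_mag [simp]: "x \<oplus> e x = x"
  and mag_absorb: "x \<oplus> f = x \<Longrightarrow> e x \<oplus> f = e x"
  using theI'[OF mag_ex1, of x] unfolding mag_def by blast+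

lemma mag_eqI: "x \<oplus> a = x \<Longrightarrow> (\<And>f. x \<oplus> f = x \<Longrightarrow> a \<oplus> f = a) \<Longrightarrow> e x = a"
  unfolding mag_def by (rule the1_equality[OF mag_ex1]) blast

lemma mag_add_mag [simp]: "e x \<oplus> e x = e x"
  by (rule mag_absorb) simp

lemma add_absorb_iff: "x \<oplus> f = x \<longleftrightarrow> e x \<oplus> f = e x"
  using mag_absorb add_assoc[of x "e x" f] by auto

lemma mag_mag [simp]: "e (e x) = e x"
  by (rule mag_eqI) simp_all

lemma add_left_comm: "x \<oplus> (y \<oplus> z) = y \<oplus> (x \<oplus> z)"
  by (metis add_assoc add_comm)

lemmas add_ac = add_assoc add_comm add_left_comm

lemma mul_left_comm: "x \<odot> (y \<odot> z) = y \<odot> (x \<odot> z)"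
  by (metis mul_assoc mul_comm)

lemmas mul_ac = mul_assoc mul_comm mul_left_comm

lemma add_mag_mag [simp]: "e x \<oplus> (e x \<oplus> y) = e x \<oplus> y"
  by (simp flip: add_assoc)

text \<open>\<open>x + y\<close> absorbs \<open>e x + e y\<close>, hence so does its magnitude. By
  A4 that magnitude is \<open>e x\<close> or \<open>e y\<close>, and idempotence makes either one
  disappear into \<open>e x + e y\<close>.\<close>

lemma mag_add: "e (x \<oplus> y) = e x \<oplus> e y"
proof -
  have "x \<oplus> y \<oplus> (e x \<oplus> e y) = (x \<oplus> e x) \<oplus> (y \<oplus> e y)"
    by (simp only: add_ac)
  then have "e (x \<oplus> y) \<oplus> (e x \<oplus> e y) = e (x \<oplus> y)"
    by (intro mag_absorb) simp
  then show ?thesis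
    using mag_add_cases[of x y] by (metis add_mag_mag add_comm)
qed

lemma mag_mul_mag [simp]: "e (e x \<odot> y) = e x \<odot> y"
  using mag_mul_ex[of x y] by auto

lemma mag_mul_mag' [simp]: "e (y \<odot> e x) = y \<odot> e x"
  by (metis mag_mul_mag mul_comm)

text \<open>O3 puts an absorbed magnitude below the absorbing one, and A4 says that of two
  magnitudes one absorbs the other. Addition of magnitudes is therefore the maximum.\<close>

lemma mag_le_iff: "e x \<sqsubseteq> e y \<longleftrightarrow> e x \<oplus> e y = e y"
proof
  assume "e x \<sqsubseteq> e y"
  moreover have "e x \<oplus> e y = e x \<or> e x \<oplus> e y = e y"
    using mag_add_cases[of x y] by (simp add: mag_add)
  moreover have "e x \<oplus> e y = e x \<Longrightarrow> e y \<sqsubseteq> e x"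
    by (rule le_magI) (simp add: add_comm)
  ultimately show "e x \<oplus> e y = e y"
    using le_antisym by metis
qed (rule le_magI)

lemma mag_le_add: "e x \<sqsubseteq> e x \<oplus> e y"
  using mag_le_iff[of x "x \<oplus> y"] by (simp add: mag_add)

lemma mag_add_le_iff: "e x \<oplus> e y \<sqsubseteq> e z \<longleftrightarrow> e x \<sqsubseteq> e z \<and> e y \<sqsubseteq> e z"
  by (metis mag_add mag_add_cases mag_le_add add_comm le_trans)

lemma mag_le_add_iff: "e x \<sqsubseteq> e y \<oplus> e z \<longleftrightarrow> e x \<sqsubseteq> e y \<or> e x \<sqsubseteq> e z"
  by (metis mag_add mag_add_cases mag_le_add add_comm le_trans)

lemma add_left_mono: "x \<sqsubseteq> y \<Longrightarrow> z \<oplus> x \<sqsubseteq> z \<oplus> y"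
  by (metis add_right_mono add_comm)

lemma zero_add: "szero pl \<oplus> x = x"
proof -
  obtain m where m: "\<And>x. m \<oplus> x = x" using zero_ex by blast
  have "szero pl = m"
    unfolding szero_def by (rule the_equality) (metis m, metis m add_comm)
  then show ?thesis by (simp add: m)
qed

lemma mag_zero: "e (szero pl) = szero pl"
  by (metis zero_add add_mag)

lemma zero_le_mag: "szero pl \<sqsubseteq> e x"
  by (rule le_magI) (rule zero_add)

lemma le_add_mag: "x \<sqsubseteq> x \<oplus> e y"
  using add_left_mono[OF zero_le_mag, of x y] zero_add add_comm by metis

subsection \<open>Additive inverses\<close>

lemma add_neg [simp]: "x \<oplus> ng x = e x"
  and mag_neg [simp]: "e (ng x) = e x"
  using theI'[OF neg_ex1, of x] unfolding neg_def by blast+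

lemma neg_eqI: "x \<oplus> s = e x \<Longrightarrow> e s = e x \<Longrightarrow> ng x = s"
  unfolding neg_def by (rule the1_equality[OF neg_ex1]) blast

lemma neg_neg [simp]: "ng (ng x) = x"
  by (rule neg_eqI) (simp_all add: add_comm[of "ng x"])

lemma neg_mag [simp]: "ng (e x) = e x"
  by (rule neg_eqI) simp_all

lemma neg_add: "ng (x \<oplus> y) = ng x \<oplus> ng y"
proof (rule neg_eqI)
  have "x \<oplus> y \<oplus> (ng x \<oplus> ng y) = (x \<oplus> ng x) \<oplus> (y \<oplus> ng y)"
    by (simp only: add_ac)
  then show "x \<oplus> y \<oplus> (ng x \<oplus> ng y) = e (x \<oplus> y)"
    by (simp add: mag_add)
qed (simp add: mag_add)

lemma le_mag_iff_neg: "x \<sqsubseteq> e x \<longleftrightarrow> e x \<sqsubseteq> ng x"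
  using add_right_mono[of x "e x" "ng x"] add_right_mono[of "e x" "ng x" x]
  by (metis add_neg add_mag add_comm mag_neg)

lemma pos_or_neg_pos: "e x \<sqsubseteq> x \<or> e x \<sqsubseteq> ng x"
  using le_total le_mag_iff_neg by metis

lemma mag_mul_neg [simp]: "e x \<odot> ng y = e x \<odot> y"
proof -
  have "e x \<odot> ng y = ng (e x \<odot> y)"
    by (metis neg_mul mul_comm)
  also have "\<dots> = e x \<odot> y"
    using neg_mag[of "e x \<odot> y"] by simp
  finally show ?thesis .
qed

subsection \<open>Multiplication by magnitudes\<close>

text \<open>By AM5 a magnitude times \<open>p\<close> does not see the sign of \<open>p\<close>, so
  \<open>p\<close> may be taken positive; O4 then treats zeroless \<open>p\<close> and O5 treats
  magnitudes.\<close>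

lemma mag_mul_right_mono:
  assumes "e x \<sqsubseteq> e y"
  shows "e x \<odot> p \<sqsubseteq> e y \<odot> p"
proof -
  have pos: "e x \<odot> q \<sqsubseteq> e y \<odot> q" if "e q \<sqsubseteq> q" for q
  proof (cases "e q = q")
    case True
    then show ?thesis
      using mag_mul_mono[of "e x" "e y" q] assms by (simp add: le_refl mul_comm)
  next
    case False
    then show ?thesis
      using mul_left_mono[OF that False assms] by (simp add: mul_comm)
  qed
  show ?thesis
    using pos_or_neg_pos[of p] pos[of p] pos[of "ng p"] by auto
qed

text \<open>With a magnitude as common factor, the correction terms of AM4 coincide with the
  left-hand side, so AM4 turns into an absorption statement.\<close>

lemma mag_mul_add_le: "e x \<odot> (y \<oplus> z) \<sqsubseteq> e x \<odot> y \<oplus> e x \<odot> z"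
proof -
  let ?B = "e x \<odot> y \<oplus> e x \<odot> z"
  have "e ?B = ?B" by (simp add: mag_add)
  moreover have "e x \<odot> (y \<oplus> z) \<oplus> ?B = ?B"
    using weak_distrib[of "e x" y z] by (simp add: add_assoc)
  ultimately show ?thesis
    using le_magI[of "e x \<odot> (y \<oplus> z)" ?B] by simp
qed

text \<open>Idempotence of magnitudes swallows factors of 2, so estimates up to a factor 2 suffice
  below.\<close>

lemma mag_mul_double_le: "e x \<odot> (y \<oplus> y) \<sqsubseteq> e x \<odot> y"
  using mag_mul_add_le[of x y y] mag_add_mag[of "e x \<odot> y"] by simp

lemma mul_mag_add: "p \<odot> (e x \<oplus> e y) = p \<odot> e x \<oplus> p \<odot> e y"
proof -
  have "e (e x \<odot> p) \<sqsubseteq> e (e y \<odot> p)" if "e x \<sqsubseteq> e y" for x y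
    using mag_mul_right_mono[OF that] by simp
  then have "p \<odot> (e x \<oplus> e y) = p \<odot> e x \<oplus> p \<odot> e y" if "e x \<sqsubseteq> e y" for x y
    using that unfolding mag_le_iff by (simp add: mul_comm)
  then show ?thesis
    using le_total[of "e x" "e y"] by (metis add_comm)
qed

lemma le_add_pos: "e y \<sqsubseteq> y \<Longrightarrow> x \<sqsubseteq> x \<oplus> y"
  using le_add_mag add_left_mono le_trans by metis

lemma mag_mul_add_pos:
  assumes "e y \<sqsubseteq> y" "e z \<sqsubseteq> z"
  shows "e x \<odot> (y \<oplus> z) = e x \<odot> y \<oplus> e x \<odot> z"
proof (rule le_antisym[OF mag_mul_add_le])
  have "e x \<odot> y \<sqsubseteq> e x \<odot> (y \<oplus> z)" "e x \<odot> z \<sqsubseteq> e x \<odot> (y \<oplus> z)"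
    using assms mag_mul_mono le_add_pos add_comm by metis+
  then show "e x \<odot> y \<oplus> e x \<odot> z \<sqsubseteq> e x \<odot> (y \<oplus> z)"
    using mag_add_le_iff[of "e x \<odot> y" "e x \<odot> z" "e x \<odot> (y \<oplus> z)"] by simp
qed

text \<open>A magnitude is its own negative, so the sign of \<open>z\<close> can be flipped without
  touching \<open>y\<close>, which reduces to positive summands.\<close>

lemma mag_mul_add_mag:
  assumes "e y = y"
  shows "e x \<odot> (y \<oplus> z) = e x \<odot> y \<oplus> e x \<odot> z"
proof (cases "e z \<sqsubseteq> z")
  case True
  then show ?thesis
    using assms by (intro mag_mul_add_pos) (simp_all add: le_refl)
next
  case False
  have "e x \<odot> (y \<oplus> z) = e x \<odot> ng (y \<oplus> z)" by simp
  also have "\<dots> = e x \<odot> (y \<oplus> ng z)"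
    using neg_mag[of y] assms by (simp add: neg_add)
  also have "\<dots> = e x \<odot> y \<oplus> e x \<odot> ng z"
    using assms False pos_or_neg_pos[of z] by (intro mag_mul_add_pos) (simp_all add: le_refl)
  finally show ?thesis by simp
qed

text \<open>If \<open>y\<close> exceeds \<open>2w\<close>, too little cancels in
  \<open>y - w\<close> for distributivity to fail; otherwise \<open>y\<close> is at most
  \<open>2w\<close>, and the factor 2 is harmless.\<close>

lemma mag_mul_diff_le:
  assumes y: "e y \<sqsubseteq> y" and w: "e w \<sqsubseteq> w"
    and ne: "e x \<odot> (y \<oplus> ng w) \<noteq> e x \<odot> y \<oplus> e x \<odot> w"
  shows "e f \<odot> y \<sqsubseteq> e f \<odot> w"
proof (cases "y \<sqsubseteq> w \<oplus> w")
  case True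
  then show ?thesis
    using mag_mul_mono[OF y] mag_mul_double_le le_trans by metis
next
  case False
  define d where "d = y \<oplus> ng w"
  have "w \<oplus> w \<oplus> ng w \<sqsubseteq> d"
    unfolding d_def using False le_total add_right_mono by metis
  then have wd: "w \<sqsubseteq> d" by (simp add: add_assoc)
  \<comment> \<open>Subtracting \<open>w\<close> and adding it back restores \<open>y\<close> only
    up to \<open>e w\<close>, which can only increase it.\<close>
  have "y \<sqsubseteq> y \<oplus> e w" by (rule le_add_mag)
  also have "y \<oplus> e w = d \<oplus> w"
    unfolding d_def by (simp add: add_assoc add_comm[of "ng w"])
  finally have yd: "y \<sqsubseteq> d \<oplus> d"
    using add_left_mono[OF wd] le_trans by metis
  have "e x \<odot> w \<sqsubseteq> e x \<odot> d"
    by (rule mag_mul_mono[OF w wd])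
  moreover have "e x \<odot> y \<sqsubseteq> e x \<odot> d"
    using mag_mul_mono[OF y yd] mag_mul_double_le le_trans by metis
  ultimately have "e x \<odot> y \<oplus> e x \<odot> w \<sqsubseteq> e x \<odot> d"
    using mag_add_le_iff[of "e x \<odot> y" "e x \<odot> w" "e x \<odot> d"] by simp
  moreover have "e x \<odot> d \<sqsubseteq> e x \<odot> y \<oplus> e x \<odot> w"
    unfolding d_def using mag_mul_add_le[of x y "ng w"] by simp
  ultimately show ?thesis
    using ne le_antisym unfolding d_def by metis
qed

lemma mag_mul_diff_eq:
  assumes "e y \<sqsubseteq> y" "e w \<sqsubseteq> w"
    and "e x \<odot> (y \<oplus> ng w) \<noteq> e x \<odot> y \<oplus> e x \<odot> w"
  shows "e f \<odot> y = e f \<odot> w"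
proof (rule le_antisym)
  show "e f \<odot> y \<sqsubseteq> e f \<odot> w" by (rule mag_mul_diff_le[OF assms])
  have "e x \<odot> (w \<oplus> ng y) = e x \<odot> ng (w \<oplus> ng y)" by simp
  also have "\<dots> = e x \<odot> (y \<oplus> ng w)" by (simp add: neg_add add_comm)
  finally show "e f \<odot> w \<sqsubseteq> e f \<odot> y"
    using assms by (intro mag_mul_diff_le[of w y x]) (simp_all add: add_comm)
qed

text \<open>Summands of equal sign distribute, so a failure comes from opposite signs, that is, from
  a difference. Failure for the single magnitude \<open>e x\<close> yields equality for every
  magnitude \<open>e f\<close>.\<close>

lemma nondistrib_mag_mul_eq:
  assumes ne: "e x \<odot> (y \<oplus> z) \<noteq> e x \<odot> y \<oplus> e x \<odot> z"
  shows "e f \<odot> y = e f \<odot> z"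
proof -
  have swap: "e x \<odot> (ng y \<oplus> ng z) = e x \<odot> (y \<oplus> z)"
    using mag_mul_neg[of x "y \<oplus> z"] by (simp add: neg_add)
  consider "e y \<sqsubseteq> y" "e z \<sqsubseteq> z" | "e y \<sqsubseteq> ng y" "e z \<sqsubseteq> ng z"
    | "e y \<sqsubseteq> y" "e z \<sqsubseteq> ng z" | "e y \<sqsubseteq> ng y" "e z \<sqsubseteq> z"
    using pos_or_neg_pos by blast
  then show ?thesis
  proof cases
    case 1
    then show ?thesis using ne mag_mul_add_pos by blast
  next
    case 2
    then show ?thesis using ne swap mag_mul_add_pos[of "ng y" "ng z" x] by simp
  next
    case 3
    then show ?thesis using ne mag_mul_diff_eq[of y "ng z" x f] by simp
  next
    case 4
    then show ?thesis using ne swap mag_mul_diff_eq[of "ng y" z x f] by simp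
  qed
qed

subsection \<open>Units and inverses\<close>

lemma mul_unt: "x \<noteq> e x \<Longrightarrow> x \<odot> u x = x"
  and unt_absorb: "x \<noteq> e x \<Longrightarrow> x \<odot> v = x \<Longrightarrow> u x \<odot> v = u x"
  using theI'[OF unt_ex1, of x] unfolding unt_def by blast+

lemma mul_minv: "x \<noteq> e x \<Longrightarrow> x \<odot> iv x = u x"
  using theI'[OF minv_ex1, of x] unfolding minv_def by blast

lemma unt_idem: "x \<noteq> e x \<Longrightarrow> u x \<odot> u x = u x"
  by (simp add: unt_absorb mul_unt)

lemma unt_zeroless:
  assumes "x \<noteq> e x"
  shows "u x \<noteq> e (u x)"
proof
  assume "u x = e (u x)"
  then have "x \<odot> e (u x) = x" using mul_unt[OF assms] by simp
  then show False using assms mag_mul_mag'[of x "u x"] by simp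
qed

text \<open>AM2 and A4 make the magnitude of the product one of \<open>x e(y)\<close> and
  \<open>y e(x)\<close>; O4 puts both below \<open>x y\<close>.\<close>

lemma mul_pos_pos:
  assumes "e x \<sqsubseteq> x" "e x \<noteq> x" "e y \<sqsubseteq> y" "e y \<noteq> y"
  shows "e (x \<odot> y) \<sqsubseteq> x \<odot> y"
proof -
  have "x \<odot> e y \<sqsubseteq> x \<odot> y"
    by (rule mul_left_mono[OF assms(1-3)])
  moreover have "y \<odot> e x \<sqsubseteq> x \<odot> y"
    using mul_left_mono[OF assms(3,4,1)] by (simp add: mul_comm)
  moreover have "e (x \<odot> y) = y \<odot> e x \<or> e (x \<odot> y) = x \<odot> e y"
    using mag_add_cases[of "y \<odot> e x" "x \<odot> e y"] mag_mul[of x y]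
    by (simp add: mag_add mul_comm)
  ultimately show ?thesis by auto
qed

text \<open>Being idempotent, \<open>u x\<close> is the square of its own negative; were it
  negative, it would be a product of two positive zeroless elements.\<close>

lemma unt_pos:
  assumes "x \<noteq> e x"
  shows "e (u x) \<sqsubseteq> u x"
proof (cases "e (u x) \<sqsubseteq> u x")
  case False
  let ?v = "ng (u x)"
  have "e ?v \<sqsubseteq> ?v" using False pos_or_neg_pos by auto
  moreover have "e ?v \<noteq> ?v"
    using unt_zeroless[OF assms] neg_mag[of "u x"] neg_neg[of "u x"] by (metis mag_neg)
  ultimately have "e (?v \<odot> ?v) \<sqsubseteq> ?v \<odot> ?v"
    by (intro mul_pos_pos)
  moreover have "?v \<odot> ?v = u x"
    using unt_idem[OF assms] neg_mul[of "u x" "u x"] neg_mul[of "u x" ?v] mul_comm[of ?v "u x"]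
    by simp
  ultimately show ?thesis by simp
qed

lemma mag_unt_mul_unt:
  assumes "x \<noteq> e x"
  shows "e (u x) \<odot> u x = e (u x)"
  using mag_mul[of "u x" "u x"] mag_add_mag[of "e (u x) \<odot> u x"] unt_idem[OF assms] by simp

lemma not_double_le:
  assumes "e x \<sqsubseteq> x" "e x \<noteq> x"
  shows "\<not> x \<oplus> x \<sqsubseteq> x"
proof
  assume "x \<oplus> x \<sqsubseteq> x"
  then have "x \<oplus> x \<oplus> ng x \<sqsubseteq> x \<oplus> ng x" by (rule add_right_mono)
  then have "x \<sqsubseteq> e x" by (simp add: add_assoc)
  then show False using le_antisym[OF assms(1)] assms(2) by blast
qed

text \<open>Common core of the bounds 1/2 and 2 for \<open>u x\<close>, applied with
  \<open>v = one\<close> and \<open>v = u x\<close>: AM4 would give \<open>u x + u x\<close> at most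
  \<open>u x\<close>.\<close>

lemma not_unt_mul_double_le:
  assumes x: "x \<noteq> e x" and v: "e (u x) \<odot> v = e (u x)" and le: "u x \<odot> (v \<oplus> v) \<sqsubseteq> u x"
    and uv: "u x \<odot> v = u x"
  shows False
proof -
  have "u x \<oplus> u x = u x \<odot> (v \<oplus> v) \<oplus> e (u x)"
    using weak_distrib[of "u x" v v] by (simp add: v uv add_assoc)
  also have "\<dots> \<sqsubseteq> u x \<oplus> e (u x)" using le by (rule add_right_mono)
  finally have "u x \<oplus> u x \<sqsubseteq> u x" by simp
  then show False
    using not_double_le[OF unt_pos[OF x] unt_zeroless[OF x, symmetric]] by blast
qed

section \<open>Comparison of the units \<open>u x\<close> with 1\<close>

definition one :: 'a where "one = (SOME w. \<forall>x. w \<odot> x = x)"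

lemma mul_one [simp]: "x \<odot> one = x"
  using someI_ex[OF one_ex] unfolding one_def mul_comm[of x] by blast

lemma unt_le_two:
  assumes x: "x \<noteq> e x"
  shows "u x \<sqsubseteq> one \<oplus> one"
proof (rule ccontr)
  assume "\<not> ?thesis"
  then have "u x \<odot> (one \<oplus> one) \<sqsubseteq> u x \<odot> u x"
    using le_total by (intro mul_left_mono[OF unt_pos[OF x] unt_zeroless[OF x, symmetric]]) blast
  then show False
    using not_unt_mul_double_le[OF x, of one] unt_idem[OF x] by simp
qed

lemma one_le_double_unt:
  assumes x: "x \<noteq> e x"
  shows "one \<sqsubseteq> u x \<oplus> u x"
proof (rule ccontr)
  assume "\<not> ?thesis"
  then have "u x \<odot> (u x \<oplus> u x) \<sqsubseteq> u x \<odot> one"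
    using le_total by (intro mul_left_mono[OF unt_pos[OF x] unt_zeroless[OF x, symmetric]]) blast
  then show False
    using not_unt_mul_double_le[OF x, of "u x"] unt_idem[OF x] mag_unt_mul_unt[OF x] by simp
qed

text \<open>O5 can be applied to \<open>one\<close> only if it is positive. If \<open>one\<close> is
  a magnitude, so is every \<open>x = x one\<close>; otherwise \<open>one\<close> is its own
  unit.\<close>

lemma one_nonneg_or_all_mag: "e one \<sqsubseteq> one \<or> (\<forall>x. e x = x)"
proof (cases "e one = one")
  case True
  then show ?thesis by (metis mag_mul_mag' mul_one)
next
  case False
  then have "u one = one" by (metis mul_unt mul_one mul_comm)
  then show ?thesis using False unt_pos[of one] by auto
qed

text \<open>The bounds 1/2 and 2 pin \<open>u x\<close> down up to factors that magnitudes
  absorb.\<close>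

lemma mag_mul_unt:
  assumes x: "x \<noteq> e x"
  shows "e f \<odot> u x = e f"
proof (rule le_antisym)
  have "e f \<odot> u x \<sqsubseteq> e f \<odot> (one \<oplus> one)"
    by (rule mag_mul_mono[OF unt_pos[OF x] unt_le_two[OF x]])
  then show "e f \<odot> u x \<sqsubseteq> e f"
    using mag_mul_double_le[of f one] le_trans by simp
  have "e f \<odot> one \<sqsubseteq> e f \<odot> (u x \<oplus> u x)"
    using one_nonneg_or_all_mag x by (intro mag_mul_mono one_le_double_unt[OF x]) metis
  then show "e f \<sqsubseteq> e f \<odot> u x"
    using mag_mul_double_le[of f "u x"] le_trans by simp
qed

lemma mag_mul_cancel:
  assumes "x \<noteq> e x"
  shows "e f \<odot> x \<odot> iv x = e f"
  using assms by (simp add: mul_assoc mul_minv mag_mul_unt)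

lemma mag_mul_cancel_le:
  assumes x: "x \<noteq> e x"
  shows "e f \<odot> x \<sqsubseteq> e g \<odot> x \<longleftrightarrow> e f \<sqsubseteq> e g"
proof
  assume "e f \<odot> x \<sqsubseteq> e g \<odot> x"
  then show "e f \<sqsubseteq> e g"
    using mag_mul_right_mono[of "e f \<odot> x" "e g \<odot> x" "iv x"] by (simp add: mag_mul_cancel[OF x])
qed (rule mag_mul_right_mono)

subsection \<open>The largest magnitude\<close>

lemma mag_add_bigM: "e x \<oplus> bigM pl = bigM pl"
  using someI_ex[OF bigM_ex] unfolding bigM_def by blast

lemma mag_le_mag_bigM: "e x \<sqsubseteq> e (bigM pl)"
  by (metis mag_add_bigM mag_add mag_mag mag_le_iff)

text \<open>E4 separates zero from the largest magnitude, and E6 puts a zeroless element between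
  them.\<close>

lemma small_zeroless_ex: "\<exists>z. z \<noteq> e z \<and> e z \<sqsubseteq> z \<and> z \<sqsubseteq> e (bigM pl)"
proof -
  let ?E = "e (bigM pl)"
  obtain x where "e x \<noteq> szero pl" using nonzero_mag_ex by blast
  then have "szero pl \<noteq> ?E"
    using zero_le_mag mag_le_mag_bigM le_antisym by metis
  then obtain z where z: "z \<noteq> e z" "szero pl \<sqsubseteq> z" "z \<sqsubseteq> ?E"
    using zeroless_between[of "szero pl" ?E] mag_zero zero_le_mag by auto
  moreover have "e z \<sqsubseteq> z"
    using add_right_mono[OF z(2), of "e z"] by (simp add: zero_add)
  ultimately show ?thesis by blast
qed

text \<open>A zeroless \<open>z\<close> below the largest magnitude is scaled up to the size of
  \<open>p\<close>. The scaled bound is again a magnitude, hence no larger than before.\<close>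

lemma le_mag_bigM: "p \<sqsubseteq> e (bigM pl)"
proof (cases "p \<sqsubseteq> e p")
  case True
  then show ?thesis using mag_le_mag_bigM le_trans by metis
next
  case False
  let ?E = "e (bigM pl)"
  from False have p: "e p \<sqsubseteq> p" "e p \<noteq> p"
    using le_total[of p "e p"] le_refl[of p] by auto
  obtain z where z: "z \<noteq> e z" "e z \<sqsubseteq> z" "z \<sqsubseteq> ?E"
    using small_zeroless_ex by blast
  \<comment> \<open>The quotient \<open>p / z\<close> is the scaling factor; \<open>q z\<close>
    recovers \<open>p\<close> only up to the unit \<open>u z\<close>.\<close>
  define q where "q = p \<odot> iv z"
  have qz: "q \<odot> z = p \<odot> u z"
    unfolding q_def using mul_minv[OF z(1)] by (simp add: mul_assoc mul_comm[of "iv z" z])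
  have qE: "q \<odot> ?E \<sqsubseteq> ?E"
    using mag_le_mag_bigM[of "q \<odot> ?E"] by simp
  have puE: "p \<odot> u z \<sqsubseteq> ?E"
  proof (cases "e q \<sqsubseteq> q")
    case True
    then have "q \<odot> z \<sqsubseteq> q \<odot> ?E"
      using mul_left_mono[OF True _ z(3)] mag_mul_mono[OF z(2,3), of q]
      by (cases "e q = q") simp_all
    then show ?thesis using qE le_trans qz by metis
  next
    case False
    \<comment> \<open>For negative \<open>q\<close> the product \<open>q z\<close> is negative, so
      it lies below its own magnitude.\<close>
    then have "e (ng q) \<sqsubseteq> ng q"
      using pos_or_neg_pos[of q] by simp
    moreover have "e (ng q) \<noteq> ng q"
      using False le_refl[of q] neg_mag[of q] neg_neg[of q] by (metis mag_neg)
    ultimately have pos: "e (ng q) \<sqsubseteq> ng q" "e (ng q) \<noteq> ng q" .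
    have "e (ng q \<odot> z) \<sqsubseteq> ng q \<odot> z"
      using z(1) by (intro mul_pos_pos[OF pos z(2)]) simp
    then have "e (q \<odot> z) \<sqsubseteq> ng (q \<odot> z)"
      by (simp flip: neg_mul)
    then have "q \<odot> z \<sqsubseteq> e (q \<odot> z)"
      by (simp add: le_mag_iff_neg)
    then show ?thesis
      using qz mag_le_mag_bigM le_trans by metis
  qed
  \<comment> \<open>The unit is removed by \<open>2 u(z)\<close> being at least 1, at the price of a
    doubling that the magnitude absorbs.\<close>
  have "p \<sqsubseteq> p \<odot> (u z \<oplus> u z)"
    using mul_left_mono[OF p one_le_double_unt[OF z(1)]] by simp
  also have "\<dots> \<sqsubseteq> p \<odot> u z \<oplus> p \<odot> u z"
    using le_add_mag[of "p \<odot> (u z \<oplus> u z)" "e p \<odot> u z"] mag_add_mag[of "e p \<odot> u z"]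
      weak_distrib[of p "u z" "u z"]
    by (simp add: add_assoc)
  also have "\<dots> \<sqsubseteq> ?E"
    using add_right_mono[OF puE, of "p \<odot> u z"] add_left_mono[OF puE, of ?E] le_trans by simp
  finally show ?thesis .
qed

text \<open>Both \<open>x\<close> and \<open>-x\<close> lie below the largest magnitude, which here
  is \<open>e x\<close>.\<close>

lemma eq_mag_if_mag_eq_bigM:
  assumes "e x = e (bigM pl)"
  shows "x = e x"
  using assms le_mag_bigM[of x] le_mag_bigM[of "ng x"] le_mag_iff_neg[of "ng x"]
  by (intro le_antisym) simp_all

lemma mag_bigM: "e (bigM pl) = bigM pl"
  using eq_mag_if_mag_eq_bigM[of "bigM pl"] by simp

subsection \<open>Relative uncertainty\<close>

abbreviation R :: "'a \<Rightarrow> 'a" where "R \<equiv> relunc pl tm"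

lemma mag_relunc [simp]: "e (R x) = R x"
  by (simp add: relunc_def mag_bigM)

lemma relunc_mul:
  assumes "x \<noteq> e x"
  shows "R x \<odot> x = e x"
  using assms mag_mul_cancel[OF assms, of x] by (simp add: relunc_def mag_unt mul_ac)

lemma mul_bigM:
  assumes "x \<noteq> e x"
  shows "bigM pl \<odot> x = bigM pl"
proof (rule le_antisym)
  show "bigM pl \<odot> x \<sqsubseteq> bigM pl"
    using le_mag_bigM mag_bigM by metis
  have "bigM pl = bigM pl \<odot> iv x \<odot> x"
    using mag_mul_cancel[OF assms, of "bigM pl"] by (simp add: mag_bigM mul_ac)
  also have "\<dots> \<sqsubseteq> bigM pl \<odot> x"
    using mag_mul_right_mono[of "e (bigM pl) \<odot> iv x" "bigM pl" x] le_mag_bigM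
      mag_mul_mag[of "bigM pl" "iv x"]
    by (simp add: mag_bigM)
  finally show "bigM pl \<sqsubseteq> bigM pl \<odot> x" .
qed

text \<open>For zeroless \<open>x\<close>, the value \<open>bigM\<close> would give
  \<open>e x = R x * x = bigM\<close>, forcing \<open>x\<close> to be a magnitude after all.\<close>

lemma relunc_eq_bigM_iff: "R x = bigM pl \<longleftrightarrow> x = e x"
proof
  assume "R x = bigM pl"
  then show "x = e x"
    using relunc_mul[of x] mul_bigM[of x] eq_mag_if_mag_eq_bigM[of x] mag_bigM by metis
qed (simp add: relunc_def)

lemma bigM_le_relunc_add:
  assumes "bigM pl \<sqsubseteq> R y \<oplus> R z"
  shows "y = e y \<or> z = e z"
proof -
  have "bigM pl \<sqsubseteq> R y \<or> bigM pl \<sqsubseteq> R z"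
    using assms mag_le_add_iff[of "bigM pl" "R y" "R z"] by (simp add: mag_bigM)
  then show ?thesis
    using le_mag_bigM mag_bigM le_antisym relunc_eq_bigM_iff by metis
qed

subsection \<open>Distributivity\<close>

lemma distrib_iff:
  "x \<odot> y \<oplus> x \<odot> z = x \<odot> (y \<oplus> z) \<longleftrightarrow>
    e x \<odot> (y \<oplus> z) = e x \<odot> y \<oplus> e x \<odot> z \<or>
    e x \<odot> y \<oplus> e x \<odot> z \<sqsubseteq> x \<odot> e y \<oplus> x \<odot> e z"
proof -
  define A where "A = e x \<odot> (y \<oplus> z)"
  define B where "B = e x \<odot> y \<oplus> e x \<odot> z"
  define C where "C = x \<odot> e y \<oplus> x \<odot> e z"
  have mags: "e A = A" "e B = B" "e C = C"
    unfolding A_def B_def C_def by (simp_all add: mag_add)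
  have "e (x \<odot> (y \<oplus> z)) = A \<oplus> C"
    unfolding A_def C_def using mag_mul[of x "y \<oplus> z"] mul_mag_add[of x y z]
    by (simp add: mag_add mul_comm[of "e y \<oplus> e z" x])
  moreover have "x \<odot> y \<oplus> x \<odot> z = x \<odot> (y \<oplus> z) \<oplus> B"
    unfolding B_def using weak_distrib[of x y z] by (simp add: add_assoc)
  \<comment> \<open>Whether \<open>x (y + z)\<close> absorbs \<open>B\<close> depends only on its
    magnitude, which is \<open>A + C\<close>.\<close>
  ultimately have "x \<odot> y \<oplus> x \<odot> z = x \<odot> (y \<oplus> z) \<longleftrightarrow> B \<oplus> (A \<oplus> C) = A \<oplus> C"
    using add_absorb_iff[of "x \<odot> (y \<oplus> z)" B] by (simp add: add_comm[of B "A \<oplus> C"])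
  also have "\<dots> \<longleftrightarrow> B \<sqsubseteq> A \<oplus> C"
    using mag_le_iff[of B "A \<oplus> C"] by (simp add: mags mag_add)
  also have "\<dots> \<longleftrightarrow> B \<sqsubseteq> A \<or> B \<sqsubseteq> C"
    using mag_le_add_iff[of B A C] by (simp add: mags)
  also have "B \<sqsubseteq> A \<longleftrightarrow> A = B"
    using mag_mul_add_le[of x y z] le_antisym[of A B] le_refl[of A] unfolding A_def B_def by auto
  finally show ?thesis
    unfolding A_def B_def C_def .
qed

lemma mag_mul_mag_le: "e x \<odot> e y \<sqsubseteq> e x \<odot> y"
  using pos_or_neg_pos[of y] mag_mul_mono[of "e y" y x] mag_mul_mono[of "e y" "ng y" x]
  by (auto simp: le_refl)

theorem distrib_iff_relunc:
  "x \<odot> y \<oplus> x \<odot> z = x \<odot> (y \<oplus> z) \<longleftrightarrow>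
    e x \<odot> (y \<oplus> z) = e x \<odot> y \<oplus> e x \<odot> z \<or> R x \<sqsubseteq> R y \<oplus> R z"
proof (cases "e x \<odot> (y \<oplus> z) = e x \<odot> y \<oplus> e x \<odot> z")
  case True
  then show ?thesis by (simp add: distrib_iff)
next
  case ne: False
  have eq: "e f \<odot> y = e f \<odot> z" for f
    by (rule nondistrib_mag_mul_eq[OF ne])
  \<comment> \<open>A magnitude among the summands would restore distributivity.\<close>
  have y: "y \<noteq> e y"
    using ne mag_mul_add_mag by metis
  have z: "z \<noteq> e z"
    using ne mag_mul_add_mag[of z x y] by (metis add_comm)
  have "e x \<odot> y \<oplus> e x \<odot> z \<sqsubseteq> x \<odot> e y \<oplus> x \<odot> e z \<longleftrightarrow> R x \<sqsubseteq> R y \<oplus> R z"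
  proof (cases "x = e x")
    case True
    \<comment> \<open>Here \<open>C\<close> is at most \<open>A\<close>, so \<open>B\<close> below
      \<open>C\<close> would collapse \<open>A\<close> and \<open>B\<close>.\<close>
    have "x \<odot> e y \<oplus> x \<odot> e z = e x \<odot> e (y \<oplus> z)"
      using True mul_mag_add[of x y z] by (simp add: mag_add)
    also have "\<dots> \<sqsubseteq> e x \<odot> (y \<oplus> z)"
      by (rule mag_mul_mag_le)
    finally have "\<not> e x \<odot> y \<oplus> e x \<odot> z \<sqsubseteq> x \<odot> e y \<oplus> x \<odot> e z"
      using ne le_antisym[OF mag_mul_add_le] le_trans by blast
    moreover have "\<not> R x \<sqsubseteq> R y \<oplus> R z"
      using True y z bigM_le_relunc_add relunc_eq_bigM_iff by metis
    ultimately show ?thesis by simp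
  next
    case x: False
    have "e x \<odot> y \<oplus> e x \<odot> z = e x \<odot> y"
      using mag_add_mag[of "e x \<odot> y"] by (simp flip: eq)
    also have "\<dots> = R x \<odot> x \<odot> y"
      by (simp add: relunc_mul[OF x])
    finally have B: "e x \<odot> y \<oplus> e x \<odot> z = R x \<odot> x \<odot> y" .
    \<comment> \<open>Taking \<open>f = R z\<close> trades the factor \<open>z\<close> for
      \<open>y\<close>, so that both terms of \<open>C\<close> share the factor
      \<open>x y\<close>.\<close>
    have "e z = R z \<odot> y"
      using relunc_mul[OF z] eq[of "R z"] by simp
    then have "x \<odot> e y \<oplus> x \<odot> e z = (x \<odot> y) \<odot> R y \<oplus> (x \<odot> y) \<odot> R z"
      using relunc_mul[OF y] by (simp add: mul_ac)
    also have "\<dots> = (R y \<oplus> R z) \<odot> x \<odot> y"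
      using mul_mag_add[of "x \<odot> y" "R y" "R z"] by (simp add: mul_ac)
    finally have C: "x \<odot> e y \<oplus> x \<odot> e z = (R y \<oplus> R z) \<odot> x \<odot> y" .
    have sum: "e (R y \<oplus> R z) = R y \<oplus> R z"
      by (simp add: mag_add)
    have "R x \<odot> x \<odot> y \<sqsubseteq> (R y \<oplus> R z) \<odot> x \<odot> y \<longleftrightarrow> R x \<odot> x \<sqsubseteq> (R y \<oplus> R z) \<odot> x"
      using mag_mul_cancel_le[OF y, of "e (R x) \<odot> x" "e (R y \<oplus> R z) \<odot> x"]
      unfolding mag_mul_mag by (simp add: sum)
    also have "\<dots> \<longleftrightarrow> R x \<sqsubseteq> R y \<oplus> R z"
      using mag_mul_cancel_le[OF x, of "R x" "R y \<oplus> R z"] by (simp add: sum)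
    finally show ?thesis unfolding B C .
  qed
  with ne show ?thesis by (simp add: distrib_iff)
qed

end

theorem mainTheorem1:
  assumes "solid pl tm le"
  shows "pl (tm x y) (tm x z) = tm x (pl y z) \<longleftrightarrow>
    (tm (mag pl x) (pl y z) = pl (tm (mag pl x) y) (tm (mag pl x) z)
     \<or> le (relunc pl tm x) (pl (relunc pl tm y) (relunc pl tm z)))"
proof -
  interpret solid_structure pl tm le
    by unfold_locales (rule assms)
  show ?thesis by (rule distrib_iff_relunc)
qed

end
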